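(* Let $A\in\mathbb{R}^{n\times m}$. Then $\mathcal{Q}'(A)=\mathcal{Q}(A)$ if and only if $\Gamma_A$ is a forest.
   Context: $\mathcal{Q}(A)$ is the set of real $n\times m$ matrices $B$ with $\mathrm{sign}\,B_{ij}=\mathrm{sign}\,A_{ij}$ for all $i,j$. $\mathcal{Q}'(A)=\{DAE\colon D\in\mathbb{R}^{n\times n},E\in\mathbb{R}^{m\times m}\text{ positive diagonal matrices}\}$. $\Gamma_A$ is the bipartite graph with vertices $X_1,\dots,X_n,Y_1,\dots,Y_m$ and an edge $X_iY_j$ iff $A_{ij}\neq0$; a forest is an acyclic graph. *)

theory Defs
  imports "HOL-Analysis.Analysis"
begin

definition qual_class :: "real ^ 'm ^ 'n \<Rightarrow> (real ^ 'm ^ 'n) set" where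
  "qual_class A = {B. \<forall>i j. sgn (B $ i $ j) = sgn (A $ i $ j)}"

definition pos_diagonal :: "real ^ 'k ^ 'k \<Rightarrow> bool" where
  "pos_diagonal D \<longleftrightarrow> (\<forall>i j. i \<noteq> j \<longrightarrow> D $ i $ j = 0) \<and> (\<forall>i. 0 < D $ i $ i)"

definition scaling_class :: "real ^ 'm ^ 'n \<Rightarrow> (real ^ 'm ^ 'n) set" where
  "scaling_class A =
    {D ** A ** E | (D :: real ^ 'n ^ 'n) (E :: real ^ 'm ^ 'm). pos_diagonal D \<and> pos_diagonal E}"

text \<open>
  An undirected simple graph is a pair of a vertex set and a set of two-element vertex sets.
  The AFP notion of a forest is not used: it is about directed graphs, where an edge together
  with its reverse already counts as a cycle.
\<close>

type_synonym 'v ugraph = "'v set \<times> 'v set set"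

text \<open>
  A cycle is given by the list of its distinct vertices, the first one not being repeated at the
  end; the index modulo the length adds the closing edge.
\<close>

definition ugraph_cycle :: "'v ugraph \<Rightarrow> 'v list \<Rightarrow> bool" where
  "ugraph_cycle G vs \<longleftrightarrow>
    3 \<le> length vs \<and> distinct vs \<and> set vs \<subseteq> fst G \<and>
    (\<forall>k < length vs. {vs ! k, vs ! (Suc k mod length vs)} \<in> snd G)"

definition ugraph_forest :: "'v ugraph \<Rightarrow> bool" where
  "ugraph_forest G \<longleftrightarrow> (\<nexists>vs. ugraph_cycle G vs)"

text \<open>The row vertex $X_i$ is \<^term>\<open>Inl i\<close> and the column vertex $Y_j$ is \<^term>\<open>Inr j\<close>.\<close>

definition bip_graph :: "real ^ 'm ^ 'n \<Rightarrow> ('n + 'm) ugraph" where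
  "bip_graph A = (UNIV, {{Inl i, Inr j} | i j. A $ i $ j \<noteq> 0})"

end

theory Submission
  imports Defs
begin

text \<open>
  Write \<open>B = DAE\<close> with \<open>p (X\<^sub>i) = D\<^sub>i\<^sub>i\<close> and \<open>p (Y\<^sub>j) = 1 / E\<^sub>j\<^sub>j\<close>: the matrices in the scaling class
  are those for which the edge weights \<open>c\<^sub>i\<^sub>j = B\<^sub>i\<^sub>j / A\<^sub>i\<^sub>j\<close> satisfy \<open>p (X\<^sub>i) = c\<^sub>i\<^sub>j * p (Y\<^sub>j)\<close> for a
  positive vertex potential \<open>p\<close>. On a forest every positive weight has a potential: adding an edge
  joins two different components, and rescaling \<open>p\<close> on one of them adjusts the new edge without
  affecting the others. On a cycle, doubling a single entry of \<open>A\<close> gives a weight without a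
  potential, since \<open>p\<close> would be constant along the rest of the cycle.
\<close>

text \<open>A walk is extended step by step; if the next vertex has already been visited, cutting
  the path back to that visit keeps its vertices distinct.\<close>

lemma rtranclp_imp_distinct_path:
  assumes "R\<^sup>*\<^sup>* u v"
  shows "\<exists>vs. vs \<noteq> [] \<and> hd vs = u \<and> last vs = v \<and> distinct vs \<and> successively R vs"
  using assms
proof (induction rule: rtranclp_induct)
  case base
  show ?case by (rule exI[of _ "[u]"]) simp
next
  case (step y z)
  then obtain vs where vs: "vs \<noteq> []" "hd vs = u" "last vs = y" "distinct vs" "successively R vs"
    by blast
  show ?case
  proof (cases "z \<in> set vs")
    case True
    then obtain xs ys where split: "vs = xs @ z # ys"
      by (meson split_list)
    have "hd (xs @ [z]) = u"
      using vs(2) split by (cases xs) auto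
    moreover have "distinct (xs @ [z])" "successively R (xs @ [z])"
      using vs(4,5) split by (auto simp: successively_append_iff)
    ultimately show ?thesis
      by (intro exI[of _ "xs @ [z]"]) simp
  next
    case False
    then show ?thesis
      using vs step.hyps(2) by (intro exI[of _ "vs @ [z]"]) (auto simp: successively_append_iff)
  qed
qed

lemma ugraph_forest_subgraph:
  assumes "ugraph_forest (V, E)" "E' \<subseteq> E"
  shows "ugraph_forest (V, E')"
proof -
  have "ugraph_cycle (V, E) vs" if "ugraph_cycle (V, E') vs" for vs
    using that assms(2) by (auto simp: ugraph_cycle_def)
  with assms(1) show ?thesis
    by (auto simp: ugraph_forest_def)
qed

text \<open>The new edge would close a simple path from \<open>u\<close> to \<open>v\<close> in
  \<open>E\<close> into a cycle. Paths with one or two vertices, too short for a cycle, are excluded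
  by \<open>u \<noteq> v\<close> and \<open>{u, v} \<notin> E\<close>.\<close>

lemma ugraph_forest_insert_edge_not_connected:
  assumes forest: "ugraph_forest (UNIV, insert {u, v} E)" and "u \<noteq> v" "{u, v} \<notin> E"
  shows "\<not> (\<lambda>x y. {x, y} \<in> E)\<^sup>*\<^sup>* u v"
proof
  assume conn: "(\<lambda>x y. {x, y} \<in> E)\<^sup>*\<^sup>* u v"
  obtain vs where vs: "vs \<noteq> []" "hd vs = u" "last vs = v" "distinct vs"
    and succ: "successively (\<lambda>x y. {x, y} \<in> E) vs"
    using rtranclp_imp_distinct_path[OF conn] by blast
  have path: "{vs ! k, vs ! Suc k} \<in> E" if "Suc k < length vs" for k
    using succ that by (simp add: successively_conv_nth)
  have ends: "vs ! 0 = u" "vs ! (length vs - 1) = v"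
    using vs by (auto simp: hd_conv_nth last_conv_nth)
  have "length vs \<noteq> 1"
    using ends \<open>u \<noteq> v\<close> by auto
  moreover have "length vs \<noteq> 2"
    using path[of 0] ends \<open>{u, v} \<notin> E\<close> by auto
  ultimately have len: "3 \<le> length vs"
    using vs(1) length_0_conv[of vs] by linarith
  have "{vs ! k, vs ! (Suc k mod length vs)} \<in> insert {u, v} E" if "k < length vs" for k
  proof (cases "Suc k = length vs")
    case True
    then have "k = length vs - 1" by simp
    with True ends show ?thesis by (simp add: insert_commute)
  next
    case False
    then show ?thesis using that path[of k] by simp
  qed
  then have "ugraph_cycle (UNIV, insert {u, v} E) vs"
    using len vs(4) by (simp add: ugraph_cycle_def)
  with forest show False
    by (auto simp: ugraph_forest_def)
qed

text \<open>Taking an arbitrary set of index pairs instead of a matrix allows induction on the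
  edges.\<close>

definition bip_edges :: "('n \<times> 'm) set \<Rightarrow> ('n + 'm) set set" where
  "bip_edges F = {{Inl i, Inr j} | i j. (i, j) \<in> F}"

lemma bip_edges_iff [simp]: "{Inl i, Inr j} \<in> bip_edges F \<longleftrightarrow> (i, j) \<in> F"
  by (auto simp: bip_edges_def doubleton_eq_iff)

lemma bip_edges_insert: "bip_edges (insert (i, j) F) = insert {Inl i, Inr j} (bip_edges F)"
  by (auto simp: bip_edges_def)

lemma forest_imp_potential:
  fixes c :: "'n \<Rightarrow> 'm \<Rightarrow> real"
  assumes "finite F" "ugraph_forest (UNIV, bip_edges F)" and c: "\<And>i j. c i j > 0"
  shows "\<exists>p. (\<forall>x. p x > 0) \<and> (\<forall>(i, j) \<in> F. p (Inl i) = c i j * p (Inr j))"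
  using assms(1,2)
proof (induction F rule: finite_induct)
  case empty
  show ?case by (rule exI[of _ "\<lambda>_. 1"]) simp
next
  case (insert e F)
  obtain a b where e: "e = (a, b)" by fastforce
  let ?R = "\<lambda>x y. {x, y} \<in> bip_edges F"
  have forest: "ugraph_forest (UNIV, insert {Inl a, Inr b} (bip_edges F))"
    using insert.prems e by (simp add: bip_edges_insert)
  then have "ugraph_forest (UNIV, bip_edges F)"
    by (rule ugraph_forest_subgraph) blast
  with insert.IH obtain p where p: "\<And>x. p x > 0"
    and pF: "\<And>i j. (i, j) \<in> F \<Longrightarrow> p (Inl i) = c i j * p (Inr j)"
    by blast
  have sep: "\<not> ?R\<^sup>*\<^sup>* (Inl a) (Inr b)"
    using forest insert.hyps(2) e by (intro ugraph_forest_insert_edge_not_connected) auto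
  \<comment> \<open>The factor solves \<open>t * p (Inl a) = c a b * p (Inr b)\<close>. It is
    applied on the component of \<open>Inl a\<close> only, which by \<open>sep\<close> does not
    contain \<open>Inr b\<close>.\<close>
  define t where "t = c a b * p (Inr b) / p (Inl a)"
  define q where "q x = (if ?R\<^sup>*\<^sup>* (Inl a) x then t * p x else p x)" for x
  have "t > 0"
    using p c by (simp add: t_def)
  then have "q x > 0" for x
    using p by (simp add: q_def)
  moreover have "q (Inl a) = c a b * q (Inr b)"
    using sep p[of "Inl a"] by (simp add: q_def t_def)
  moreover have "q (Inl i) = c i j * q (Inr j)" if "(i, j) \<in> F" for i j
  proof -
    \<comment> \<open>Both ends of an old edge lie in the same component, so both sides of its
      equation are scaled alike.\<close>
    have "?R (Inl i) (Inr j)" "?R (Inr j) (Inl i)"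
      using that by (simp_all add: insert_commute)
    then have "?R\<^sup>*\<^sup>* (Inl a) (Inl i) \<longleftrightarrow> ?R\<^sup>*\<^sup>* (Inl a) (Inr j)"
      by (metis (mono_tags, lifting) rtranclp.rtrancl_into_rtrancl)
    then show ?thesis
      using pF[OF that] by (simp add: q_def)
  qed
  ultimately show ?case
    using e by blast
qed

lemma bip_graph_eq: "bip_graph A = (UNIV, bip_edges {(i, j). A $ i $ j \<noteq> 0})"
  by (simp add: bip_graph_def bip_edges_def)

lemma pos_diagonal_mult_nth:
  assumes "pos_diagonal D" "pos_diagonal E"
  shows "(D ** A ** E) $ i $ j = D $ i $ i * A $ i $ j * E $ j $ j"
proof -
  have D: "(D ** A) $ i $ k = D $ i $ i * A $ i $ k" for k
  proof -
    have "(D ** A) $ i $ k = (\<Sum>l\<in>UNIV. D $ i $ l * A $ l $ k)"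
      by (simp add: matrix_matrix_mult_def)
    also have "\<dots> = (\<Sum>l\<in>{i}. D $ i $ l * A $ l $ k)"
      using assms(1) by (intro sum.mono_neutral_right) (auto simp: pos_diagonal_def)
    finally show ?thesis by simp
  qed
  have "(D ** A ** E) $ i $ j = (\<Sum>l\<in>UNIV. (D ** A) $ i $ l * E $ l $ j)"
    by (simp add: matrix_matrix_mult_def)
  also have "\<dots> = (\<Sum>l\<in>{j}. (D ** A) $ i $ l * E $ l $ j)"
    using assms(2) by (intro sum.mono_neutral_right) (auto simp: pos_diagonal_def)
  finally show ?thesis by (simp add: D)
qed

text \<open>The equation is kept free of division so that it also covers the zero entries of
  \<open>A\<close>, where it forces \<open>B\<close> to vanish.\<close>

lemma scaling_class_iff_potential:
  fixes A :: "real ^ 'm ^ 'n"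
  shows "B \<in> scaling_class A \<longleftrightarrow>
    (\<exists>p. (\<forall>x. p x > 0) \<and> (\<forall>i j. B $ i $ j * p (Inr j) = p (Inl i) * A $ i $ j))"
proof
  assume "B \<in> scaling_class A"
  then obtain D E where B: "B = D ** A ** E" and DE: "pos_diagonal D" "pos_diagonal E"
    by (auto simp: scaling_class_def)
  have pos: "D $ i $ i > 0" "E $ j $ j > 0" for i j
    using DE by (auto simp: pos_diagonal_def)
  define p where "p = case_sum (\<lambda>i. D $ i $ i) (\<lambda>j. 1 / E $ j $ j)"
  have "p x > 0" for x
    using pos by (cases x) (simp_all add: p_def)
  moreover have "B $ i $ j * p (Inr j) = p (Inl i) * A $ i $ j" for i j
    using pos(2)[of j] by (simp add: B pos_diagonal_mult_nth[OF DE] p_def)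
  ultimately show "\<exists>p. (\<forall>x. p x > 0) \<and> (\<forall>i j. B $ i $ j * p (Inr j) = p (Inl i) * A $ i $ j)"
    by blast
next
  assume "\<exists>p. (\<forall>x. p x > 0) \<and> (\<forall>i j. B $ i $ j * p (Inr j) = p (Inl i) * A $ i $ j)"
  then obtain p where p: "\<And>x. p x > 0"
    and B: "\<And>i j. B $ i $ j * p (Inr j) = p (Inl i) * A $ i $ j"
    by blast
  define D :: "real ^ 'n ^ 'n" where "D = (\<chi> i k. if i = k then p (Inl i) else 0)"
  define E :: "real ^ 'm ^ 'm" where "E = (\<chi> j k. if j = k then 1 / p (Inr j) else 0)"
  have DE: "pos_diagonal D" "pos_diagonal E"
    using p by (simp_all add: pos_diagonal_def D_def E_def)
  have "B $ i $ j = (D ** A ** E) $ i $ j" for i j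
    unfolding pos_diagonal_mult_nth[OF DE]
    using B[of i j] p[of "Inr j"] by (simp add: D_def E_def field_simps)
  then have "B = D ** A ** E"
    by (simp add: vec_eq_iff)
  with DE show "B \<in> scaling_class A"
    by (auto simp: scaling_class_def)
qed

lemma scaling_class_subset_qual_class: "scaling_class A \<subseteq> qual_class A"
proof
  fix B assume "B \<in> scaling_class A"
  then obtain p where p: "\<And>x. p x > 0"
    and B: "\<And>i j. B $ i $ j * p (Inr j) = p (Inl i) * A $ i $ j"
    unfolding scaling_class_iff_potential by blast
  have "sgn (B $ i $ j) = sgn (A $ i $ j)" for i j
    using arg_cong[OF B[of i j], of sgn] p by (simp add: sgn_mult)
  then show "B \<in> qual_class A"
    by (simp add: qual_class_def)
qed

lemma forest_imp_qual_class_subset: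
  assumes "ugraph_forest (bip_graph A)"
  shows "qual_class A \<subseteq> scaling_class A"
proof
  fix B assume "B \<in> qual_class A"
  then have sgn_eq: "sgn (B $ i $ j) = sgn (A $ i $ j)" for i j
    by (simp add: qual_class_def)
  \<comment> \<open>The value 1 off the edges makes \<open>c\<close> positive everywhere, as
    \<open>forest_imp_potential\<close> demands; elsewhere the quotient is positive because the
    signs agree.\<close>
  define c where "c i j = (if A $ i $ j = 0 then 1 else B $ i $ j / A $ i $ j)" for i j
  have "c i j > 0" for i j
    using sgn_eq[of i j] by (auto simp: c_def sgn_if zero_less_divide_iff split: if_splits)
  then obtain p where p: "\<And>x. p x > 0"
    and pe: "\<And>i j. A $ i $ j \<noteq> 0 \<Longrightarrow> p (Inl i) = c i j * p (Inr j)"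
    using forest_imp_potential[of "{(i, j). A $ i $ j \<noteq> 0}" c] assms
    unfolding bip_graph_eq by auto
  have "B $ i $ j * p (Inr j) = p (Inl i) * A $ i $ j" for i j
    using sgn_eq[of i j] pe[of i j] by (cases "A $ i $ j = 0") (auto simp: c_def sgn_0_0)
  with p show "B \<in> scaling_class A"
    unfolding scaling_class_iff_potential by blast
qed

lemma cycle_imp_not_qual_class_subset:
  assumes "ugraph_cycle (bip_graph A) vs"
  shows "\<not> qual_class A \<subseteq> scaling_class A"
proof
  assume sub: "qual_class A \<subseteq> scaling_class A"
  define n where "n = length vs"
  have n: "3 \<le> n" and dist: "distinct vs"
    and edge: "\<And>k. k < n \<Longrightarrow> {vs ! k, vs ! (Suc k mod n)} \<in> snd (bip_graph A)"
    using assms by (auto simp: ugraph_cycle_def n_def)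
  \<comment> \<open>The closing edge carries the doubled entry, so that the other edges form a path
    through consecutive indices.\<close>
  have "{vs ! (n - 1), vs ! 0} \<in> snd (bip_graph A)"
    using edge[of "n - 1"] n by simp
  then obtain a b where ab: "{vs ! (n - 1), vs ! 0} = {Inl a, Inr b}" "A $ a $ b \<noteq> 0"
    by (auto simp: bip_graph_def)
  define B where "B = (\<chi> i j. if i = a \<and> j = b then 2 * A $ i $ j else A $ i $ j)"
  have "B \<in> qual_class A"
    by (simp add: B_def qual_class_def sgn_mult)
  with sub have "B \<in> scaling_class A" ..
  then obtain p where p: "\<And>x. p x > 0"
    and Bp: "\<And>i j. B $ i $ j * p (Inr j) = p (Inl i) * A $ i $ j"
    unfolding scaling_class_iff_potential by blast
  have step: "p (vs ! Suc k) = p (vs ! k)" if k: "Suc k < n" for k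
  proof -
    obtain i j where ij: "{vs ! k, vs ! Suc k} = {Inl i, Inr j}" "A $ i $ j \<noteq> 0"
      using edge[of k] k by (auto simp: bip_graph_def)
    \<comment> \<open>Here \<open>3 \<le> n\<close> is essential: a coincidence with the closing
      edge would force \<open>k = 0\<close> and \<open>n = 2\<close>.\<close>
    have "{vs ! k, vs ! Suc k} \<noteq> {vs ! (n - 1), vs ! 0}"
    proof
      assume "{vs ! k, vs ! Suc k} = {vs ! (n - 1), vs ! 0}"
      then have "vs ! Suc k = vs ! 0 \<or> vs ! k = vs ! 0 \<and> vs ! Suc k = vs ! (n - 1)"
        by (auto simp: doubleton_eq_iff)
      moreover have "vs ! x = vs ! y \<longleftrightarrow> x = y" if "x < n" "y < n" for x y
        using dist that by (simp add: nth_eq_iff_index_eq n_def)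
      ultimately have "Suc k = 0 \<or> k = 0 \<and> Suc k = n - 1"
        using k n by simp
      with n show False by auto
    qed
    then have "\<not> (i = a \<and> j = b)"
      using ij(1) ab(1) by auto
    then have "p (Inr j) = p (Inl i)"
      using Bp[of i j] ij(2) by (auto simp: B_def)
    then show ?thesis
      using ij(1) by (auto simp: doubleton_eq_iff)
  qed
  have const: "p (vs ! k) = p (vs ! 0)" if "k < n" for k
    using that by (induction k) (simp_all add: step)
  have "p (vs ! (n - 1)) = p (vs ! 0)"
    using n by (intro const) simp
  then have "p (Inl a) = p (Inr b)"
    using ab(1) by (auto simp: doubleton_eq_iff)
  \<comment> \<open>The doubled entry demands \<open>p (Inl a) = 2 * p (Inr b)\<close>, which
    contradicts equality of two positive values.\<close>
  then show False
    using Bp[of a b] ab(2) p[of "Inr b"] by (simp add: B_def)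
qed

theorem theorem6:
  fixes A :: "real ^ 'm ^ 'n"
  shows "scaling_class A = qual_class A \<longleftrightarrow> ugraph_forest (bip_graph A)"
  using scaling_class_subset_qual_class[of A] forest_imp_qual_class_subset[of A]
    cycle_imp_not_qual_class_subset[of A]
  unfolding ugraph_forest_def by blast

end
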